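(* Let $M$ be one of the groups $\mathbb{Z}_2$, $\mathbb{Z}_3$, $\mathbb{Z}_2^2=\mathbb{Z}_2\times\mathbb{Z}_2$, $\mathbb{Z}_4$. Then every directed graph $G=(V,E)$ has the strong homomorphism property for $M$: for every abelian group $M'$, every mapping $m\colon M\to M'$ (not necessarily a group homomorphism) and every $M$-flow $\varphi\colon E\to M$ on $G$, there exists an $M'$-flow $\varphi'\colon E\to M'$ on $G$ such that $\varphi'(e)\in\mathcal{H}_m(\varphi(e))$ for all $e\in E$.
   Context: Graphs are finite directed graphs; loops and parallel edges are allowed. For an abelian group $M$, an $M$-flow on $G=(V,E)$ is a mapping $\varphi\colon E\to M$ such that at every vertex $v$ the sum of $\varphi$ over edges leaving $v$ minus the sum of $\varphi$ over edges entering $v$ is $0$ (the value $0$ is allowed on edges). For abelian groups $M,M'$, any mapping $m\colon M\to M'$ and $x\in M$, the homomorphic image of $x$ is $\mathcal{H}_m(x):=\{\,m(a+x)-m(a) : a\in M\,\}\subseteq M'$. *)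

theory Defs
  imports "HOL-Algebra.FiniteProduct" "HOL-Algebra.Elementary_Groups" "Graph_Theory.Digraph"
begin

(* HOL-Algebra writes groups multiplicatively: the product over the outgoing arcs times the
   inverse of the product over the incoming arcs is "flow out minus flow in".  A loop at v
   lies both in out_arcs G v and in in_arcs G v.  Values outside arcs G are irrelevant. *)
definition group_flow ::
    "('v, 'e) pre_digraph \<Rightarrow> ('m, 'x) monoid_scheme \<Rightarrow> ('e \<Rightarrow> 'm) \<Rightarrow> bool" where
  "group_flow G M \<phi> \<longleftrightarrow>
     \<phi> \<in> arcs G \<rightarrow> carrier M \<and>
     (\<forall>v \<in> verts G.
        finprod M \<phi> (out_arcs G v) \<otimes>\<^bsub>M\<^esub> inv\<^bsub>M\<^esub> (finprod M \<phi> (in_arcs G v)) = \<one>\<^bsub>M\<^esub>)"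

definition hom_image ::
    "('m, 'x) monoid_scheme \<Rightarrow> ('n, 'y) monoid_scheme \<Rightarrow> ('m \<Rightarrow> 'n) \<Rightarrow> 'm \<Rightarrow> 'n set" where
  "hom_image M M' m x = {m (a \<otimes>\<^bsub>M\<^esub> x) \<otimes>\<^bsub>M'\<^esub> inv\<^bsub>M'\<^esub> (m a) | a. a \<in> carrier M}"

(* The type argument is the element type of the target groups M'; a formula cannot quantify
   over types, so a theorem leaving 'n free ranges over all abelian groups M'. *)
definition strong_hom_property ::
    "'n itself \<Rightarrow> ('v, 'e) pre_digraph \<Rightarrow> ('m, 'x) monoid_scheme \<Rightarrow> bool" where
  "strong_hom_property (_ :: 'n itself) G M \<longleftrightarrow>
     (\<forall>(M' :: 'n monoid) m \<phi>.
        comm_group M' \<longrightarrow> m \<in> carrier M \<rightarrow> carrier M' \<longrightarrow> group_flow G M \<phi> \<longrightarrow>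
        (\<exists>\<phi>'. group_flow G M' \<phi>' \<and> (\<forall>e \<in> arcs G. \<phi>' e \<in> hom_image M M' m (\<phi> e))))"

end

theory Submission
  imports Defs
begin

text \<open>
  A map \<open>m\<close> from \<open>M\<close> to an abelian group extends to a homomorphism on the free abelian group with
  basis \<open>M\<close>. So it suffices to treat that free group: given an \<open>M\<close>-flow \<open>\<phi>\<close>, one looks for a
  family of integer flows \<open>x\<^sub>j\<close>, indexed by \<open>j \<in> M\<close>, whose value on an arc \<open>e\<close> is
  \<open>\<delta>\<^bsub>b + \<phi>(e)\<^esub> - \<delta>\<^sub>b\<close> for some \<open>b \<in> M\<close> depending on \<open>e\<close>. Then \<open>\<phi>'(e) = \<Sum>\<^sub>j x\<^sub>j(e) m(j)\<close> is a flow
  in the target and equals \<open>m(b + \<phi>(e)) - m(b)\<close> (\<open>strong_hom_propertyI\<close>).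

  The integer flows come from one integrality theorem (\<open>integral_division\<close>, a form of Tutte's
  theorem that flows modulo \<open>n\<close> lift to integer \<open>n\<close>-flows): if all divergences of an
  integer function \<open>a\<close> are divisible by \<open>n\<close>, then the real function \<open>a / n\<close> can be rounded up or
  down on every arc to an integer function with the same divergences as \<open>a / n\<close>.

  For \<open>\<int>\<^sub>n\<close> with \<open>n = 2, 3, 4\<close>, lift \<open>\<phi>\<close> to integers \<open>a\<close>, with the largest residue read as \<open>-1\<close>,
  and write \<open>a = y\<^sub>0 + \<dots> + y\<^bsub>n-1\<^esub>\<close> with all \<open>y\<^sub>i\<close> having the same divergences. The differences
  \<open>x\<^sub>j = y\<^bsub>j-1\<^esub> - y\<^sub>j\<close> are then flows, and \<open>y\<^sub>i(e)\<close> tells whether the walk from \<open>b\<close> to \<open>b + \<phi>(e)\<close> around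
  the cycle uses the step from \<open>i\<close> to \<open>i + 1\<close>. Repeated integral division produces the \<open>y\<^sub>i\<close>:
  a third and then half of the rest for \<open>n = 3\<close>; halves of halves for \<open>n = 4\<close>, where the first halving
  separates the even from the odd positions. That is what makes an arc of value 2 use two
  adjacent steps, whichever way the halves are divided afterwards.

  For \<open>\<int>\<^sub>2 \<times> \<int>\<^sub>2\<close>, each of the three nontrivial homomorphisms to \<open>\<int>\<^sub>2\<close> turns \<open>\<phi>\<close> into a \<open>\<int>\<^sub>2\<close>-flow, which
  lifts to an integer flow with values in \<open>{-1, 0, 1}\<close>. Half of the signed sums of these
  three flows, with signs from the character table, are the wanted \<open>x\<^sub>j\<close>; if \<open>\<phi>\<close> is
  nowhere zero, they form an orientable double cover of the graph by four even subgraphs.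
\<close>

section \<open>Divergence and integral rounding\<close>

text \<open>
  Tail and head are arbitrary functions here, rather than those of a digraph, because the proof
  below contracts arcs by changing these functions while keeping the arc set. A loop contributes
  nothing.
\<close>
definition net :: "'e set \<Rightarrow> ('e \<Rightarrow> 'v) \<Rightarrow> ('e \<Rightarrow> 'v) \<Rightarrow> ('e \<Rightarrow> 'a::comm_ring_1) \<Rightarrow> 'v \<Rightarrow> 'a" where
  "net E t h f w = (\<Sum>e\<in>E. f e * (of_bool (t e = w) - of_bool (h e = w)))"

lemma net_add: "net E t h (\<lambda>e. f e + g e) w = net E t h f w + net E t h g w"
  by (simp add: net_def distrib_right sum.distrib)

lemma net_diff: "net E t h (\<lambda>e. f e - g e) w = net E t h f w - net E t h g w"
  by (simp add: net_def left_diff_distrib sum_subtractf)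

lemma net_scale: "net E t h (\<lambda>e. c * f e) w = c * net E t h f w"
  by (simp add: net_def sum_distrib_left mult.assoc)

lemma net_of_int: "net E t h (\<lambda>e. of_int (f e)) w = of_int (net E t h f w)"
  by (simp add: net_def)

text \<open>
  Contract a non-loop arc \<open>a\<close> from \<open>u\<close> to \<open>v\<close>. The divergence at the merged vertex is the sum of
  those at \<open>u\<close> and \<open>v\<close>, so it stays integral and induction gives a circulation on the
  contracted graph. Its divergences at \<open>u\<close> and \<open>v\<close> in the original graph are opposite, and
  the value on \<open>a\<close> can be chosen to cancel both. Integrality is what excludes that \<open>a\<close> is the only arc,
  as the divergence at \<open>u\<close> would be fractional. A loop is itself a circulation.
\<close>
lemma fractional_arcs_carry_circulation:
  fixes x :: "'e \<Rightarrow> real" and t h :: "'e \<Rightarrow> 'v"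
  assumes "finite F" "F \<noteq> {}" "\<And>e. e \<in> F \<Longrightarrow> x e \<notin> \<int>" "\<And>w. net F t h x w \<in> \<int>"
  shows "\<exists>z::'e \<Rightarrow> real. (\<exists>e\<in>F. z e \<noteq> 0) \<and> (\<forall>w. net F t h z w = 0)"
  using assms
proof (induction F arbitrary: t h rule: finite_induct)
  case empty
  then show ?case by simp
next
  case (insert a F)
  have net_insert: "net (insert a F) t h f w = f a * (of_bool (t a = w) - of_bool (h a = w)) + net F t h f w"
    for f :: "'e \<Rightarrow> real" and w
    using insert.hyps by (simp add: net_def)
  define u v where "u = t a" and "v = h a"
  show ?case
  proof (cases "u = v")
    case True
    then have "net (insert a F) t h (\<lambda>e. of_bool (e = a)) w = (0::real)" for w
      using insert.hyps by (auto simp: net_insert u_def v_def net_def intro!: sum.neutral)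
    then show ?thesis by (intro exI[of _ "\<lambda>e. of_bool (e = a)"]) auto
  next
    case False
    define c where "c = id(v := u)"
    have contract: "net F (c \<circ> t) (c \<circ> h) f w =
        (if w = v then 0 else if w = u then net F t h f u + net F t h f v else net F t h f w)"
      for f :: "'e \<Rightarrow> real" and w
      unfolding net_def using False
      by (auto simp: c_def sum.distrib[symmetric] intro!: sum.cong sum.neutral)
    have "net F (c \<circ> t) (c \<circ> h) x w \<in> \<int>" for w
    proof -
      have "net F t h x u + net F t h x v = net (insert a F) t h x u + net (insert a F) t h x v"
        using False by (simp add: net_insert u_def v_def)
      moreover have "net F t h x w = net (insert a F) t h x w" if "w \<noteq> u" "w \<noteq> v"
        using that by (simp add: net_insert u_def v_def)
      ultimately show ?thesis
        using insert.prems(3) by (auto simp: contract)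
    qed
    moreover have "F \<noteq> {}"
    proof
      assume "F = {}"
      then have "net (insert a F) t h x u = x a"
        using False by (simp add: net_def u_def v_def)
      then show False using insert.prems(2,3) by (metis insertI1)
    qed
    ultimately have "\<exists>z::'e \<Rightarrow> real. (\<exists>e\<in>F. z e \<noteq> 0) \<and> (\<forall>w. net F (c \<circ> t) (c \<circ> h) z w = 0)"
      using insert.prems(2) by (intro insert.IH) blast+
    then obtain z :: "'e \<Rightarrow> real"
      where z: "\<exists>e\<in>F. z e \<noteq> 0" "\<And>w. net F (c \<circ> t) (c \<circ> h) z w = 0"
      by blast
    define z' where "z' = z(a := net F t h z v)"
    have z'_a: "z' a = net F t h z v" by (simp add: z'_def)
    have z'_F: "net F t h z' w = net F t h z w" for w
      using insert.hyps by (auto simp: net_def z'_def intro!: sum.cong)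
    have "net (insert a F) t h z' w = 0" for w
      using z(2)[of u] z(2)[of w] False
      by (auto simp: contract net_insert z'_F z'_a u_def[symmetric] v_def[symmetric] split: if_splits)
    moreover have "\<exists>e\<in>insert a F. z' e \<noteq> 0"
      using z(1) insert.hyps by (auto simp: z'_def)
    ultimately show ?thesis by blast
  qed
qed

text \<open>
  Push \<open>x\<close> along a circulation supported on the fractional arcs until some value first
  becomes an integer. This keeps the divergences and stays between the floor and the
  ceiling of the original values, while the number of fractional arcs drops.
\<close>
lemma integral_rounding:
  fixes x :: "'e \<Rightarrow> real" and t h :: "'e \<Rightarrow> 'v"
  assumes "finite E" "\<And>w. net E t h x w \<in> \<int>"
  shows "\<exists>y::'e \<Rightarrow> int. (\<forall>w. of_int (net E t h y w) = net E t h x w) \<and>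
           (\<forall>e\<in>E. \<lfloor>x e\<rfloor> \<le> y e \<and> y e \<le> \<lceil>x e\<rceil>)"
  using assms(2)
proof (induction "card {e \<in> E. x e \<notin> \<int>}" arbitrary: x rule: less_induct)
  case less
  define F where "F = {e \<in> E. x e \<notin> \<int>}"
  have fin: "finite F" using assms(1) by (simp add: F_def)
  have split: "net E t h f w = net F t h f w + net (E - F) t h f w" for f :: "'e \<Rightarrow> real" and w
    using assms(1) by (simp add: net_def F_def sum.subset_diff[of F E] subset_iff add.commute)
  show ?case
  proof (cases "F = {}")
    case True
    then have "x e = of_int \<lfloor>x e\<rfloor>" if "e \<in> E" for e
      using that by (auto simp: F_def elim: Ints_cases)
    then have "net E t h x w = net E t h (\<lambda>e. of_int \<lfloor>x e\<rfloor>) w" for w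
      unfolding net_def by (intro sum.cong) auto
    then show ?thesis
      by (intro exI[of _ "\<lambda>e. \<lfloor>x e\<rfloor>"]) (auto simp: net_of_int floor_le_ceiling)
  next
    case False
    have "net F t h x w \<in> \<int>" for w
    proof -
      have "net (E - F) t h x w \<in> \<int>"
        unfolding net_def by (intro Ints_sum Ints_mult) (auto simp: F_def of_bool_def)
      then show ?thesis
        using less.prems[of w] Ints_diff by (fastforce simp: split[of x])
    qed
    then obtain z0 :: "'e \<Rightarrow> real" where z0: "\<exists>e\<in>F. z0 e \<noteq> 0" "\<And>w. net F t h z0 w = 0"
      using fractional_arcs_carry_circulation[OF fin False, of x t h] by (auto simp: F_def)
    define z where "z = (\<lambda>e. if e \<in> F then z0 e else 0)"
    have z_net: "net E t h z w = 0" for w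
    proof -
      have "net F t h z w = net F t h z0 w" "net (E - F) t h z w = 0"
        unfolding net_def z_def by (auto intro!: sum.cong sum.neutral)
      then show ?thesis using z0(2) by (simp add: split)
    qed
    (* For an arc e that the circulation uses, tau e is the time at which its value hits the next
       integer; the first of these times is the length s of the push. *)
    define S where "S = {e \<in> F. z e \<noteq> 0}"
    define \<tau> where "\<tau> e = (of_int (if z e > 0 then \<lceil>x e\<rceil> else \<lfloor>x e\<rfloor>) - x e) / z e" for e
    define s where "s = Min (\<tau> ` S)"
    have S: "finite S" "S \<noteq> {}" using fin z0(1) by (auto simp: S_def z_def)
    have frac: "of_int \<lfloor>x e\<rfloor> < x e" "x e < of_int \<lceil>x e\<rceil>" if "e \<in> S" for e
    proof -
      have "x e \<notin> \<int>" using that by (simp add: S_def F_def)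
      then have "of_int \<lfloor>x e\<rfloor> \<noteq> x e" "of_int \<lceil>x e\<rceil> \<noteq> x e"
        by (metis Ints_of_int)+
      then show "of_int \<lfloor>x e\<rfloor> < x e" "x e < of_int \<lceil>x e\<rceil>"
        using of_int_floor_le[of "x e"] le_of_int_ceiling[of "x e"] by linarith+
    qed
    have s_le: "s \<le> \<tau> e" if "e \<in> S" for e using S that by (simp add: s_def)
    have "\<tau> e > 0" if "e \<in> S" for e
      using frac[OF that] that by (auto simp: \<tau>_def S_def divide_neg_neg)
    then have s_pos: "s > 0" using S by (simp add: s_def)
    have "s \<in> \<tau> ` S" unfolding s_def using S by (intro Min_in) auto
    then obtain b where b: "b \<in> S" "s = \<tau> b" by blast
    define x' where "x' e = x e + s * z e" for e
    have x'_net: "net E t h x' w = net E t h x w" for w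
      by (simp add: x'_def[abs_def] net_add net_scale z_net)
    have cell: "of_int \<lfloor>x e\<rfloor> \<le> x' e \<and> x' e \<le> of_int \<lceil>x e\<rceil>" if "e \<in> E" for e
    proof (cases "e \<in> S")
      case True
      show ?thesis
      proof (cases "z e > 0")
        case True
        then have "s * z e \<le> of_int \<lceil>x e\<rceil> - x e"
          using s_le[OF \<open>e \<in> S\<close>] by (simp add: \<tau>_def pos_le_divide_eq)
        then show ?thesis
          using frac[OF \<open>e \<in> S\<close>] mult_pos_pos[OF s_pos True] unfolding x'_def by linarith
      next
        case False
        then have neg: "z e < 0" using \<open>e \<in> S\<close> by (auto simp: S_def)
        then have "s * z e \<ge> of_int \<lfloor>x e\<rfloor> - x e"
          using s_le[OF \<open>e \<in> S\<close>] by (simp add: \<tau>_def neg_le_divide_eq)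
        then show ?thesis
          using frac[OF \<open>e \<in> S\<close>] mult_pos_neg[OF s_pos neg] unfolding x'_def by linarith
      qed
    next
      case False
      then have "x' e = x e" by (auto simp: x'_def S_def z_def)
      then show ?thesis by simp
    qed
    have "{e \<in> E. x' e \<notin> \<int>} \<subseteq> F - {b}"
    proof
      fix e assume e: "e \<in> {e \<in> E. x' e \<notin> \<int>}"
      have "x' b = of_int (if z b > 0 then \<lceil>x b\<rceil> else \<lfloor>x b\<rfloor>)"
        using b(1) by (simp add: x'_def b(2) \<tau>_def S_def)
      then have "e \<noteq> b" using e by (metis (mono_tags, lifting) Ints_of_int mem_Collect_eq)
      moreover have "e \<in> F" using e by (cases "e \<in> F") (auto simp: x'_def z_def F_def)
      ultimately show "e \<in> F - {b}" by simp
    qed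
    moreover have "b \<in> F" using b by (simp add: S_def)
    ultimately have "card {e \<in> E. x' e \<notin> \<int>} < card {e \<in> E. x e \<notin> \<int>}"
      using fin by (intro psubset_card_mono) (auto simp: F_def[symmetric])
    then obtain y :: "'e \<Rightarrow> int" where y: "\<And>w. of_int (net E t h y w) = net E t h x' w"
      "\<And>e. e \<in> E \<Longrightarrow> \<lfloor>x' e\<rfloor> \<le> y e \<and> y e \<le> \<lceil>x' e\<rceil>"
      using less.hyps[of x'] less.prems by (auto simp: x'_net)
    have "\<lfloor>x e\<rfloor> \<le> y e \<and> y e \<le> \<lceil>x e\<rceil>" if "e \<in> E" for e
    proof -
      have "\<lfloor>x e\<rfloor> \<le> \<lfloor>x' e\<rfloor>" "\<lceil>x' e\<rceil> \<le> \<lceil>x e\<rceil>"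
        using cell[OF that] by (auto simp: le_floor_iff ceiling_le_iff)
      then show ?thesis using y(2)[OF that] by linarith
    qed
    then show ?thesis using y(1) x'_net by auto
  qed
qed

text \<open>
  Rounding \<open>a / n\<close>. Besides giving a part of \<open>a\<close> with an \<open>n\<close>-th of its divergence, this yields the
  integer flow \<open>n y - a\<close>, congruent to \<open>-a\<close> modulo \<open>n\<close> and smaller than \<open>n\<close> in absolute value.
\<close>
lemma integral_division:
  fixes a :: "'e \<Rightarrow> int" and t h :: "'e \<Rightarrow> 'v"
  assumes "finite E" "n > 0" "\<And>w. n dvd net E t h a w"
  shows "\<exists>y. (\<forall>w. n * net E t h y w = net E t h a w) \<and> (\<forall>e\<in>E. \<bar>n * y e - a e\<bar> < n)"
proof -
  let ?x = "\<lambda>e. (1 / of_int n) * (of_int (a e) :: real)"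
  have x: "of_int n * net E t h ?x w = of_int (net E t h a w)" for w
    unfolding net_scale net_of_int using assms(2) by simp
  have "net E t h ?x w \<in> \<int>" for w
  proof -
    obtain k where "net E t h a w = n * k" using assms(3) by blast
    then show ?thesis using x[of w] assms(2) by simp
  qed
  then obtain y :: "'e \<Rightarrow> int" where y: "\<And>w. of_int (net E t h y w) = net E t h ?x w"
    "\<And>e. e \<in> E \<Longrightarrow> \<lfloor>?x e\<rfloor> \<le> y e \<and> y e \<le> \<lceil>?x e\<rceil>"
    using integral_rounding[OF assms(1), of t h ?x] by blast
  have "real_of_int (n * net E t h y w) = of_int (net E t h a w)" for w
    using x[of w] y(1)[of w] by simp
  then have "n * net E t h y w = net E t h a w" for w
    by (simp only: of_int_eq_iff)
  moreover have "\<bar>n * y e - a e\<bar> < n" if "e \<in> E" for e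
  proof -
    have "\<bar>of_int (y e) - ?x e\<bar> < 1"
      using y(2)[OF that] by linarith
    then have "of_int n * \<bar>of_int (y e) - ?x e\<bar> < of_int n"
      using assms(2) by simp
    also have "of_int n * \<bar>of_int (y e) - ?x e\<bar> = \<bar>of_int n * (of_int (y e) - ?x e)\<bar>"
      using assms(2) by (simp add: abs_mult)
    also have "of_int n * (of_int (y e) - ?x e) = of_int (n * y e - a e)"
      using assms(2) by (simp add: right_diff_distrib)
    finally show ?thesis by linarith
  qed
  ultimately show ?thesis by blast
qed

lemma quotient_of_unit:
  fixes n a y :: int
  assumes "\<bar>n * y - a\<bar> < n" "\<bar>a\<bar> \<le> 1"
  shows "y \<in> {0, a}"
proof -
  have "n * y < n * 2" "n * (- 2) < n * y" using assms by linarith+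
  moreover have "n > 0" using assms(1) by linarith
  ultimately have "y < 2" "- 2 < y" by (simp_all only: mult_less_cancel_left_pos)
  then have "y \<in> {- 1, 0, 1}" by auto
  then show ?thesis using assms by auto
qed

section \<open>Group-valued flows\<close>

lemma dvd_net_if_cong:
  fixes a f :: "'e \<Rightarrow> int"
  assumes "\<And>e. e \<in> E \<Longrightarrow> n dvd a e - f e" "n dvd net E t h f w"
  shows "n dvd net E t h a w"
proof -
  have "n dvd net E t h (\<lambda>e. a e - f e) w"
    unfolding net_def using assms(1) by (intro dvd_sum dvd_mult2) auto
  then show ?thesis using dvd_add[OF _ assms(2)] by (fastforce simp: net_diff)
qed

abbreviation divergence :: "('v, 'e) pre_digraph \<Rightarrow> ('e \<Rightarrow> 'a::comm_ring_1) \<Rightarrow> 'v \<Rightarrow> 'a" where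
  "divergence G \<equiv> net (arcs G) (tail G) (head G)"

lemma divergence_eq:
  assumes "fin_digraph G"
  shows "divergence G f v = sum f (out_arcs G v) - sum f (in_arcs G v)"
proof -
  interpret fin_digraph G by fact
  have "sum f {e \<in> arcs G. P e} = (\<Sum>e\<in>arcs G. f e * of_bool (P e))" for P
    unfolding sum.inter_filter[OF finite_arcs] by (intro sum.cong) auto
  then show ?thesis
    by (simp add: net_def out_arcs_def in_arcs_def right_diff_distrib sum_subtractf)
qed

lemma divergence_outside:
  assumes "fin_digraph G" "v \<notin> verts G"
  shows "divergence G f v = 0"
proof -
  interpret fin_digraph G by fact
  show ?thesis using assms(2) by (auto simp: net_def intro!: sum.neutral)
qed

lemma (in comm_group) finprod_int_pow:
  assumes "finite A" "g \<in> carrier G"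
  shows "(\<Otimes>e\<in>A. g [^] (c e :: int)) = g [^] sum c A"
  using assms by (induction A rule: finite_induct) (auto simp: int_pow_mult Pi_def)

lemma (in comm_group) finprod_hom:
  assumes "comm_group H" "h \<in> hom G H" "finite A" "f \<in> A \<rightarrow> carrier G"
  shows "h (finprod G f A) = finprod H (\<lambda>a. h (f a)) A"
proof -
  interpret H: comm_group H by fact
  show ?thesis using assms(3,4)
  proof (induction A rule: finite_induct)
    case empty
    then show ?case using hom_one[OF assms(2)] H.is_group is_group by simp
  next
    case (insert a A)
    then have "(\<lambda>a. h (f a)) \<in> insert a A \<rightarrow> carrier H"
      using hom_in_carrier[OF assms(2)] by blast
    then show ?case using insert by (simp add: hom_mult[OF assms(2)] Pi_def)
  qed
qed

lemma group_flow_iff: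
  assumes "comm_group N"
  shows "group_flow G N \<phi> \<longleftrightarrow> \<phi> \<in> arcs G \<rightarrow> carrier N \<and>
    (\<forall>v\<in>verts G. finprod N \<phi> (out_arcs G v) = finprod N \<phi> (in_arcs G v))"
proof -
  interpret comm_group N by fact
  have "a \<otimes>\<^bsub>N\<^esub> inv\<^bsub>N\<^esub> b = \<one>\<^bsub>N\<^esub> \<longleftrightarrow> a = b" if "a \<in> carrier N" "b \<in> carrier N" for a b
    using that inv_equality[of a "inv\<^bsub>N\<^esub> b"] by auto
  moreover have "finprod N \<phi> (out_arcs G v) \<in> carrier N" "finprod N \<phi> (in_arcs G v) \<in> carrier N"
    if "\<phi> \<in> arcs G \<rightarrow> carrier N" for v
    using that by (auto intro!: finprod_closed simp: out_arcs_def in_arcs_def)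
  ultimately show ?thesis unfolding group_flow_def by blast
qed

lemma group_flow_hom:
  assumes "fin_digraph G" "comm_group M" "comm_group N" "h \<in> hom M N" "group_flow G M \<phi>"
  shows "group_flow G N (\<lambda>e. h (\<phi> e))"
proof -
  interpret fin_digraph G by fact
  interpret M: comm_group M by fact
  have \<phi>: "\<phi> \<in> arcs G \<rightarrow> carrier M"
    using assms(5) by (simp add: group_flow_def)
  then have "h (finprod M \<phi> (out_arcs G v)) = finprod N (\<lambda>e. h (\<phi> e)) (out_arcs G v)"
    "h (finprod M \<phi> (in_arcs G v)) = finprod N (\<lambda>e. h (\<phi> e)) (in_arcs G v)" for v
    by (auto intro!: M.finprod_hom[OF assms(3,4)] simp: out_arcs_def in_arcs_def)
  then show ?thesis
    using assms(5) \<phi> hom_in_carrier[OF assms(4)]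
    by (simp add: group_flow_iff[OF assms(2)] group_flow_iff[OF assms(3)] Pi_iff) metis
qed

lemma finprod_integer_mod_group:
  assumes "finite A" "f \<in> A \<rightarrow> carrier (integer_mod_group n)"
  shows "finprod (integer_mod_group n) f A = sum f A mod int n"
proof -
  interpret comm_group "integer_mod_group n" by simp
  show ?thesis
    using assms by (induction A rule: finite_induct) (auto simp: Pi_def mod_add_right_eq)
qed

lemma integer_mod_group_flow_divergence:
  assumes "fin_digraph G" "group_flow G (integer_mod_group n) \<phi>"
  shows "int n dvd divergence G \<phi> v"
proof (cases "v \<in> verts G")
  case True
  interpret fin_digraph G by fact
  have \<phi>: "\<phi> \<in> out_arcs G v \<rightarrow> carrier (integer_mod_group n)"
    "\<phi> \<in> in_arcs G v \<rightarrow> carrier (integer_mod_group n)"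
    using assms(2) by (auto simp: group_flow_def)
  have "finprod (integer_mod_group n) \<phi> (out_arcs G v) = finprod (integer_mod_group n) \<phi> (in_arcs G v)"
    using assms(2) True by (simp add: group_flow_iff)
  then have "sum \<phi> (out_arcs G v) mod int n = sum \<phi> (in_arcs G v) mod int n"
    using finprod_integer_mod_group[OF _ \<phi>(1)] finprod_integer_mod_group[OF _ \<phi>(2)]
    by (simp add: out_arcs_def in_arcs_def)
  then show ?thesis
    by (simp add: divergence_eq[OF assms(1)] mod_eq_dvd_iff)
next
  case False
  then show ?thesis by (simp add: divergence_outside[OF assms(1)])
qed

lemma group_flow_int_combination:
  assumes "fin_digraph G" "comm_group N" "finite J" "m \<in> J \<rightarrow> carrier N"
    "\<And>j v. j \<in> J \<Longrightarrow> divergence G (\<lambda>e. x e j :: int) v = 0"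
  shows "group_flow G N (\<lambda>e. \<Otimes>\<^bsub>N\<^esub>j\<in>J. m j [^]\<^bsub>N\<^esub> x e j)"
proof -
  interpret fin_digraph G by fact
  interpret N: comm_group N by fact
  have fin: "finite (out_arcs G v)" "finite (in_arcs G v)" for v
    by (simp_all add: out_arcs_def in_arcs_def)
  show ?thesis using assms(3-5)
  proof (induction J rule: finite_induct)
    case empty
    then show ?case by (simp add: group_flow_def)
  next
    case (insert i J)
    let ?f = "\<lambda>e. m i [^]\<^bsub>N\<^esub> x e i"
    let ?g = "\<lambda>e. \<Otimes>\<^bsub>N\<^esub>j\<in>J. m j [^]\<^bsub>N\<^esub> x e j"
    have m: "m i \<in> carrier N" "m \<in> J \<rightarrow> carrier N" using insert.prems(1) by auto
    have f: "?f e \<in> carrier N" and g: "?g e \<in> carrier N" for e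
      using m by (auto intro!: N.finprod_closed)
    have eq: "(\<Otimes>\<^bsub>N\<^esub>j\<in>insert i J. m j [^]\<^bsub>N\<^esub> x e j) = ?f e \<otimes>\<^bsub>N\<^esub> ?g e" for e
      using insert.hyps m by (intro N.finprod_insert) auto
    have mult: "(\<Otimes>\<^bsub>N\<^esub>e\<in>A. ?f e \<otimes>\<^bsub>N\<^esub> ?g e) = finprod N ?f A \<otimes>\<^bsub>N\<^esub> finprod N ?g A" for A
      using f g by (intro N.finprod_multf) auto
    have "sum (\<lambda>e. x e i) (out_arcs G v) = sum (\<lambda>e. x e i) (in_arcs G v)" for v
      using insert.prems(2)[of i v] by (simp add: divergence_eq[OF assms(1)])
    then have "finprod N ?f (out_arcs G v) = finprod N ?f (in_arcs G v)" for v
      using m by (simp add: N.finprod_int_pow fin)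
    moreover have "group_flow G N ?g"
      using insert.IH[OF m(2)] insert.prems(2) by simp
    ultimately show ?case
      using f g by (simp add: group_flow_iff[OF assms(2)] eq mult)
  qed
qed

text \<open>
  The reduction to the free abelian group on \<open>M\<close>: the family \<open>x e\<close> is the coordinate vector of
  \<open>\<delta>\<^bsub>b + \<phi>(e)\<^esub> - \<delta>\<^sub>b\<close>, and the extension of the map \<open>m\<close> sends it to a member of the homomorphic image.
\<close>
lemma strong_hom_propertyI:
  assumes "fin_digraph G" "group M" "finite (carrier M)"
    and lift: "\<And>\<phi>. group_flow G M \<phi> \<Longrightarrow> \<exists>x::'e \<Rightarrow> 'm \<Rightarrow> int.
      (\<forall>j\<in>carrier M. \<forall>v. divergence G (\<lambda>e. x e j) v = 0) \<and>
      (\<forall>e\<in>arcs G. \<exists>b\<in>carrier M. \<forall>j\<in>carrier M. x e j = of_bool (j = b \<otimes>\<^bsub>M\<^esub> \<phi> e) - of_bool (j = b))"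
  shows "strong_hom_property TYPE('n) (G :: ('v, 'e) pre_digraph) (M :: ('m, 'x) monoid_scheme)"
  unfolding strong_hom_property_def
proof (intro allI impI)
  fix N :: "'n monoid" and m \<phi>
  assume "comm_group N" and m: "m \<in> carrier M \<rightarrow> carrier N" and \<phi>: "group_flow G M \<phi>"
  interpret N: comm_group N by fact
  interpret M: group M by fact
  obtain x :: "'e \<Rightarrow> 'm \<Rightarrow> int" where
    flow: "\<And>j v. j \<in> carrier M \<Longrightarrow> divergence G (\<lambda>e. x e j) v = 0" and
    arc: "\<And>e. e \<in> arcs G \<Longrightarrow>
      \<exists>b\<in>carrier M. \<forall>j\<in>carrier M. x e j = of_bool (j = b \<otimes>\<^bsub>M\<^esub> \<phi> e) - of_bool (j = b)"
    using lift[OF \<phi>] by blast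
  let ?\<phi>' = "\<lambda>e. \<Otimes>\<^bsub>N\<^esub>j\<in>carrier M. m j [^]\<^bsub>N\<^esub> x e j"
  have pick: "(\<Otimes>\<^bsub>N\<^esub>j\<in>carrier M. m j [^]\<^bsub>N\<^esub> (of_bool (j = i) :: int)) = m i" if "i \<in> carrier M" for i
  proof -
    have "(\<Otimes>\<^bsub>N\<^esub>j\<in>carrier M. m j [^]\<^bsub>N\<^esub> (of_bool (j = i) :: int)) =
        (\<Otimes>\<^bsub>N\<^esub>j\<in>carrier M. if i = j then m j else \<one>\<^bsub>N\<^esub>)"
      using m that funcset_mem[OF m] by (intro N.finprod_cong') (auto simp: N.int_pow_1)
    then show ?thesis
      using N.finprod_singleton[OF that assms(3) m] by simp
  qed
  have "?\<phi>' e \<in> hom_image M N m (\<phi> e)" if e: "e \<in> arcs G" for e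
  proof -
    obtain b where b: "b \<in> carrier M"
      "\<And>j. j \<in> carrier M \<Longrightarrow> x e j = of_bool (j = b \<otimes>\<^bsub>M\<^esub> \<phi> e) - of_bool (j = b)"
      using arc[OF e] by blast
    have b': "b \<otimes>\<^bsub>M\<^esub> \<phi> e \<in> carrier M"
      using b(1) \<phi> e by (auto simp: group_flow_def)
    let ?p = "\<lambda>i j. m j [^]\<^bsub>N\<^esub> (of_bool (j = i) :: int)"
    have "?\<phi>' e \<otimes>\<^bsub>N\<^esub> m b = ?\<phi>' e \<otimes>\<^bsub>N\<^esub> (\<Otimes>\<^bsub>N\<^esub>j\<in>carrier M. ?p b j)"
      by (simp only: pick[OF b(1)])
    also have "\<dots> = (\<Otimes>\<^bsub>N\<^esub>j\<in>carrier M. m j [^]\<^bsub>N\<^esub> x e j \<otimes>\<^bsub>N\<^esub> ?p b j)"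
      using m by (intro N.finprod_multf[symmetric]) auto
    also have "\<dots> = (\<Otimes>\<^bsub>N\<^esub>j\<in>carrier M. ?p (b \<otimes>\<^bsub>M\<^esub> \<phi> e) j)"
    proof (rule N.finprod_cong')
      show "m j [^]\<^bsub>N\<^esub> x e j \<otimes>\<^bsub>N\<^esub> ?p b j = ?p (b \<otimes>\<^bsub>M\<^esub> \<phi> e) j" if "j \<in> carrier M" for j
        using b(2)[OF that] N.int_pow_mult[OF funcset_mem[OF m that], symmetric] by simp
    qed (use m in auto)
    also have "\<dots> = m (b \<otimes>\<^bsub>M\<^esub> \<phi> e)" by (rule pick[OF b'])
    finally have eq: "?\<phi>' e \<otimes>\<^bsub>N\<^esub> m b = m (b \<otimes>\<^bsub>M\<^esub> \<phi> e)" .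
    have closed: "?\<phi>' e \<in> carrier N" "m b \<in> carrier N"
      using m b(1) by (auto intro!: N.finprod_closed)
    have "?\<phi>' e = m (b \<otimes>\<^bsub>M\<^esub> \<phi> e) \<otimes>\<^bsub>N\<^esub> inv\<^bsub>N\<^esub> m b"
      by (rule iffD2[OF N.inv_solve_right[OF closed(1) funcset_mem[OF m b'] closed(2)] eq[symmetric]])
    then show ?thesis using b(1) by (auto simp: hom_image_def)
  qed
  then show "\<exists>\<phi>'. group_flow G N \<phi>' \<and> (\<forall>e\<in>arcs G. \<phi>' e \<in> hom_image M N m (\<phi> e))"
    using group_flow_int_combination[OF assms(1) \<open>comm_group N\<close> assms(3) m, of x] flow by blast
qed

section \<open>Cyclic groups\<close>

text \<open>
  View \<open>\<int>\<^sub>n\<close> as a directed cycle whose \<open>i\<close>-th step leads from \<open>i\<close> to \<open>i + 1\<close>, and let \<open>y i e\<close> be the signed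
  number of times that step is used on \<open>e\<close>. The coordinate of the resulting displacement at
  \<open>j\<close> is what step \<open>j - 1\<close> brings in minus what step \<open>j\<close> takes away. Equal divergences
  of all \<open>y i\<close> suffice, as only these differences have to be flows.
  The representatives \<open>- 1, \<dots>, n - 2\<close> keep most values among \<open>- 1, 0, 1\<close>, which rounding
  splits into parts that are either \<open>0\<close> or everything (\<open>quotient_of_unit\<close>).
\<close>
lemma strong_hom_property_cyclic:
  fixes G :: "('v, 'e) pre_digraph"
  assumes G: "fin_digraph G" and "n > 0"
    and decomp: "\<And>a. (\<And>e. e \<in> arcs G \<Longrightarrow> - 1 \<le> a e \<and> a e < int n - 1) \<Longrightarrow>
      (\<And>v. int n dvd divergence G a v) \<Longrightarrow>
      \<exists>(y :: int \<Rightarrow> 'e \<Rightarrow> int) (k :: 'v \<Rightarrow> int). (\<forall>i\<in>{0..<int n}. \<forall>v. divergence G (y i) v = k v) \<and>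
        (\<forall>e\<in>arcs G. \<exists>b\<in>{0..<int n}. \<forall>j\<in>{0..<int n}.
           y ((j - 1) mod int n) e - y j e = of_bool (j = (b + a e) mod int n) - of_bool (j = b))"
  shows "strong_hom_property TYPE('n) G (integer_mod_group n)"
proof (rule strong_hom_propertyI[OF G])
  have M: "carrier (integer_mod_group n) = {0..<int n}"
    using \<open>n > 0\<close> by (simp add: carrier_integer_mod_group)
  then show "finite (carrier (integer_mod_group n))" by simp
  fix \<phi> assume \<phi>: "group_flow G (integer_mod_group n) \<phi>"
  define a where "a e = (if \<phi> e = int n - 1 then - 1 else \<phi> e)" for e
  have "- 1 \<le> a e \<and> a e < int n - 1" if "e \<in> arcs G" for e
    using \<phi> that \<open>n > 0\<close> M by (fastforce simp: a_def group_flow_def Pi_iff)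
  moreover have "int n dvd divergence G a v" for v
    by (rule dvd_net_if_cong[OF _ integer_mod_group_flow_divergence[OF G \<phi>]]) (auto simp: a_def)
  ultimately obtain y :: "int \<Rightarrow> 'e \<Rightarrow> int" and k :: "'v \<Rightarrow> int"
    where flow: "\<And>i v. i \<in> {0..<int n} \<Longrightarrow> divergence G (y i) v = k v" and
    arc: "\<And>e. e \<in> arcs G \<Longrightarrow> \<exists>b\<in>{0..<int n}. \<forall>j\<in>{0..<int n}.
      y ((j - 1) mod int n) e - y j e = of_bool (j = (b + a e) mod int n) - of_bool (j = b)"
    using decomp[of a] by blast
  have "(b + a e) mod int n = (b + \<phi> e) mod int n" for b e
    by (simp add: a_def mod_eq_dvd_iff)
  then show "\<exists>x::'e \<Rightarrow> int \<Rightarrow> int.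
      (\<forall>j\<in>carrier (integer_mod_group n). \<forall>v. divergence G (\<lambda>e. x e j) v = 0) \<and>
      (\<forall>e\<in>arcs G. \<exists>b\<in>carrier (integer_mod_group n). \<forall>j\<in>carrier (integer_mod_group n).
        x e j = of_bool (j = b \<otimes>\<^bsub>integer_mod_group n\<^esub> \<phi> e) - of_bool (j = b))"
    using flow arc \<open>n > 0\<close>
    by (intro exI[of _ "\<lambda>e j. y ((j - 1) mod int n) e - y j e"]) (auto simp: M net_diff)
qed simp

lemma strong_hom_property_Z2:
  fixes G :: "('v, 'e) pre_digraph"
  assumes G: "fin_digraph G"
  shows "strong_hom_property TYPE('n) G (integer_mod_group 2)"
proof (rule strong_hom_property_cyclic[OF G], simp)
  interpret fin_digraph G by fact
  have range: "{0..<int 2} = {0, 1}" by auto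
  fix a assume a: "\<And>e. e \<in> arcs G \<Longrightarrow> - 1 \<le> a e \<and> a e < int 2 - 1"
    and div: "\<And>v. int 2 dvd divergence G a v"
  obtain y where y: "\<And>v. 2 * divergence G y v = divergence G a v" "\<And>e. e \<in> arcs G \<Longrightarrow> \<bar>2 * y e - a e\<bar> < 2"
    using integral_division[OF finite_arcs, of 2 "tail G" "head G" a] div by auto
  let ?y = "\<lambda>i::int. if i = 0 then y else (\<lambda>e. a e - y e)"
  have "\<forall>i\<in>{0..<int 2}. \<forall>v. divergence G (?y i) v = divergence G y v"
    unfolding range by (simp add: net_diff y(1)[symmetric])
  moreover have "\<exists>b\<in>{0..<int 2}. \<forall>j\<in>{0..<int 2}.
      ?y ((j - 1) mod int 2) e - ?y j e = of_bool (j = (b + a e) mod int 2) - of_bool (j = b)"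
    if "e \<in> arcs G" for e
  proof -
    have "(a e, y e) \<in> {(0, 0), (- 1, 0), (- 1, - 1)}"
      using a[OF that] quotient_of_unit[OF y(2)[OF that]] by auto
    then show ?thesis unfolding range by (elim insertE) simp_all
  qed
  ultimately show "\<exists>(y :: int \<Rightarrow> 'e \<Rightarrow> int) (k :: 'v \<Rightarrow> int). (\<forall>i\<in>{0..<int 2}. \<forall>v. divergence G (y i) v = k v) \<and>
        (\<forall>e\<in>arcs G. \<exists>b\<in>{0..<int 2}. \<forall>j\<in>{0..<int 2}.
           y ((j - 1) mod int 2) e - y j e = of_bool (j = (b + a e) mod int 2) - of_bool (j = b))"
    by (intro exI[of _ ?y] exI[of _ "divergence G y"]) blast
qed

text \<open>
  A third is split off first; the rest has twice its divergence and is halved. An arc of value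
  \<open>\<plusminus>1\<close> gives its whole value to exactly one of the three parts, and any single step of the
  3-cycle is a displacement by one.
\<close>
lemma strong_hom_property_Z3:
  fixes G :: "('v, 'e) pre_digraph"
  assumes G: "fin_digraph G"
  shows "strong_hom_property TYPE('n) G (integer_mod_group 3)"
proof (rule strong_hom_property_cyclic[OF G], simp)
  interpret fin_digraph G by fact
  have range: "{0..<int 3} = {0, 1, 2}" by auto
  fix a assume a: "\<And>e. e \<in> arcs G \<Longrightarrow> - 1 \<le> a e \<and> a e < int 3 - 1"
    and div: "\<And>v. int 3 dvd divergence G a v"
  obtain y0 where y0: "\<And>v. 3 * divergence G y0 v = divergence G a v" "\<And>e. e \<in> arcs G \<Longrightarrow> \<bar>3 * y0 e - a e\<bar> < 3"
    using integral_division[OF finite_arcs, of 3 "tail G" "head G" a] div by auto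
  let ?r = "\<lambda>e. a e - y0 e"
  have r: "divergence G ?r v = 2 * divergence G y0 v" for v
    by (simp add: net_diff y0(1)[symmetric])
  obtain y1 where y1: "\<And>v. 2 * divergence G y1 v = divergence G ?r v" "\<And>e. e \<in> arcs G \<Longrightarrow> \<bar>2 * y1 e - ?r e\<bar> < 2"
    using integral_division[OF finite_arcs, of 2 "tail G" "head G" ?r] by (auto simp: r)
  let ?y = "\<lambda>i::int. if i = 0 then y0 else if i = 1 then y1 else (\<lambda>e. ?r e - y1 e)"
  have "divergence G y1 v = divergence G y0 v" for v
    using y1(1)[of v] by (simp add: r)
  then have "\<forall>i\<in>{0..<int 3}. \<forall>v. divergence G (?y i) v = divergence G y0 v"
    unfolding range by (simp add: net_diff y0(1)[symmetric])
  moreover have "\<exists>b\<in>{0..<int 3}. \<forall>j\<in>{0..<int 3}.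
      ?y ((j - 1) mod int 3) e - ?y j e = of_bool (j = (b + a e) mod int 3) - of_bool (j = b)"
    if "e \<in> arcs G" for e
  proof -
    have "(a e, y0 e, y1 e) \<in> {(0, 0, 0), (1, 1, 0), (1, 0, 1), (1, 0, 0),
        (- 1, - 1, 0), (- 1, 0, - 1), (- 1, 0, 0)}"
    proof -
      have "a e \<in> {- 1, 0, 1}" using a[OF that] by auto
      moreover from this have "y0 e \<in> {0, a e}"
        using quotient_of_unit[OF y0(2)[OF that]] by auto
      moreover from calculation have "y1 e \<in> {0, a e - y0 e}"
        using quotient_of_unit[OF y1(2)[OF that]] by auto
      ultimately show ?thesis by (elim insertE emptyE) simp_all
    qed
    then show ?thesis unfolding range by (elim insertE) simp_all
  qed
  ultimately show "\<exists>(y :: int \<Rightarrow> 'e \<Rightarrow> int) (k :: 'v \<Rightarrow> int). (\<forall>i\<in>{0..<int 3}. \<forall>v. divergence G (y i) v = k v) \<and>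
        (\<forall>e\<in>arcs G. \<exists>b\<in>{0..<int 3}. \<forall>j\<in>{0..<int 3}.
           y ((j - 1) mod int 3) e - y j e = of_bool (j = (b + a e) mod int 3) - of_bool (j = b))"
    by (intro exI[of _ ?y] exI[of _ "divergence G y0"]) blast
qed

text \<open>
  Halving \<open>a\<close> into \<open>p + q\<close> gives an arc of value 2 one unit in each half. Now \<open>p\<close> is divided among the
  steps 0 and 2, and \<open>q\<close> among the steps 1 and 3. Such an arc thus uses one step of each kind,
  and these are always adjacent, so that they form a walk of length two.
\<close>
lemma strong_hom_property_Z4:
  fixes G :: "('v, 'e) pre_digraph"
  assumes G: "fin_digraph G"
  shows "strong_hom_property TYPE('n) G (integer_mod_group 4)"
proof (rule strong_hom_property_cyclic[OF G], simp)
  interpret fin_digraph G by fact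
  have range: "{0..<int 4} = {0, 1, 2, 3}" by auto
  fix a assume a: "\<And>e. e \<in> arcs G \<Longrightarrow> - 1 \<le> a e \<and> a e < int 4 - 1"
    and div: "\<And>v. int 4 dvd divergence G a v"
  have half: "\<exists>y. (\<forall>v. 2 * divergence G y v = divergence G f v) \<and> (\<forall>e\<in>arcs G. \<bar>2 * y e - f e\<bar> < 2)"
    if "\<And>v. 2 dvd divergence G f v" for f :: "'e \<Rightarrow> int"
    using that by (intro integral_division) simp_all
  have "2 dvd divergence G a v" for v
    using div[of v] by (auto intro: dvd_trans[of 2 4])
  then obtain p where p: "\<And>v. 2 * divergence G p v = divergence G a v" "\<And>e. e \<in> arcs G \<Longrightarrow> \<bar>2 * p e - a e\<bar> < 2"
    using half by blast
  define q where "q e = a e - p e" for e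
  have q: "divergence G q v = divergence G p v" for v
    using p(1)[of v] by (simp add: q_def[abs_def] net_diff)
  have p_even: "2 dvd divergence G p v" for v
    using div[of v] p(1)[of v] dvd_mult_cancel_left[of 2 2 "divergence G p v"] by simp
  obtain y0 where y0: "\<And>v. 2 * divergence G y0 v = divergence G p v" "\<And>e. e \<in> arcs G \<Longrightarrow> \<bar>2 * y0 e - p e\<bar> < 2"
    using half[OF p_even] by blast
  obtain y1 where y1: "\<And>v. 2 * divergence G y1 v = divergence G q v" "\<And>e. e \<in> arcs G \<Longrightarrow> \<bar>2 * y1 e - q e\<bar> < 2"
    using half[of q] p_even by (auto simp: q)
  let ?y = "\<lambda>i::int. if i = 0 then y0 else if i = 1 then y1 else if i = 2 then (\<lambda>e. p e - y0 e)
    else (\<lambda>e. q e - y1 e)"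
  have "divergence G y1 v = divergence G y0 v" for v
    using y0(1)[of v] y1(1)[of v] by (simp add: q)
  then have "\<forall>i\<in>{0..<int 4}. \<forall>v. divergence G (?y i) v = divergence G y0 v"
    unfolding range by (simp add: net_diff q y0(1)[symmetric])
  moreover have "\<exists>b\<in>{0..<int 4}. \<forall>j\<in>{0..<int 4}.
      ?y ((j - 1) mod int 4) e - ?y j e = of_bool (j = (b + a e) mod int 4) - of_bool (j = b)"
    if "e \<in> arcs G" for e
  proof -
    have "(a e, p e) \<in> {(0, 0), (2, 1), (1, 1), (1, 0), (- 1, - 1), (- 1, 0)}"
    proof (cases "a e = 2")
      case True
      then show ?thesis using p(2)[OF that] by auto
    next
      case False
      then have "a e \<in> {- 1, 0, 1}" using a[OF that] by auto
      moreover from this have "p e \<in> {0, a e}"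
        using quotient_of_unit[OF p(2)[OF that]] by auto
      ultimately show ?thesis by (elim insertE emptyE) simp_all
    qed
    moreover from this have "y0 e \<in> {0, p e}" "y1 e \<in> {0, q e}"
      using quotient_of_unit[OF y0(2)[OF that]] quotient_of_unit[OF y1(2)[OF that]]
      by (auto simp: q_def)
    ultimately have "(a e, p e, y0 e, y1 e) \<in> {(0, 0, 0, 0),
        (1, 1, 0, 0), (1, 1, 1, 0), (1, 0, 0, 0), (1, 0, 0, 1),
        (- 1, - 1, 0, 0), (- 1, - 1, - 1, 0), (- 1, 0, 0, 0), (- 1, 0, 0, - 1),
        (2, 1, 0, 0), (2, 1, 0, 1), (2, 1, 1, 0), (2, 1, 1, 1)}"
      unfolding q_def by (elim insertE emptyE) simp_all
    then show ?thesis unfolding range q_def by (elim insertE) simp_all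
  qed
  ultimately show "\<exists>(y :: int \<Rightarrow> 'e \<Rightarrow> int) (k :: 'v \<Rightarrow> int). (\<forall>i\<in>{0..<int 4}. \<forall>v. divergence G (y i) v = k v) \<and>
        (\<forall>e\<in>arcs G. \<exists>b\<in>{0..<int 4}. \<forall>j\<in>{0..<int 4}.
           y ((j - 1) mod int 4) e - y j e = of_bool (j = (b + a e) mod int 4) - of_bool (j = b))"
    by (intro exI[of _ ?y] exI[of _ "divergence G y0"]) blast
qed

section \<open>The Klein four-group\<close>

text \<open>
  On an arc where \<open>f\<close> is odd, rounding \<open>f / 2\<close> up or down chooses a sign; on the other
  arcs there is nothing to round.
\<close>
lemma sign_flow:
  fixes f :: "'e \<Rightarrow> int"
  assumes "fin_digraph G" "\<And>v. 2 dvd divergence G f v"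
  shows "\<exists>s. (\<forall>v. divergence G s v = 0) \<and> (\<forall>e\<in>arcs G. s e \<in> {f e mod 2, - (f e mod 2)})"
proof -
  interpret fin_digraph G by fact
  obtain y where y: "\<And>v. 2 * divergence G y v = divergence G f v" "\<And>e. e \<in> arcs G \<Longrightarrow> \<bar>2 * y e - f e\<bar> < 2"
    using integral_division[OF finite_arcs, of 2 "tail G" "head G" f] assms(2) by auto
  have "divergence G (\<lambda>e. 2 * y e - f e) v = 0" for v
    by (simp add: net_diff net_scale y(1))
  moreover have "2 * y e - f e \<in> {f e mod 2, - (f e mod 2)}" if "e \<in> arcs G" for e
    using y(2)[OF that] by (simp, presburger)
  ultimately show ?thesis by (intro exI[of _ "\<lambda>e. 2 * y e - f e"]) blast
qed

text \<open>
  On an arc with a nonzero value \<open>c\<close>, exactly two of the three sign flows are nonzero, namely those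
  of the characters that are nontrivial on \<open>c\<close>. Halving the signed sums leaves two opposite units on
  the elements of one coset of \<open>{0, c}\<close>, which is a displacement by \<open>c\<close>; the signs
  decide which coset and which direction. The sums are even on every arc, so the halves are
  integer flows.
\<close>
lemma strong_hom_property_Z2_Z2:
  fixes G :: "('v, 'e) pre_digraph"
  assumes G: "fin_digraph G"
  shows "strong_hom_property TYPE('n) G (integer_mod_group 2 \<times>\<times> integer_mod_group 2)"
proof -
  interpret fin_digraph G by fact
  let ?Z = "integer_mod_group 2"
  let ?M = "?Z \<times>\<times> ?Z"
  have Z: "carrier ?Z = {0, 1}" by (auto simp: carrier_integer_mod_group)
  have M_carrier: "carrier ?M = {(0, 0), (1, 0), (0, 1), (1, 1)}" by (auto simp: Z)
  have M: "group ?M" by (simp add: DirProd_group)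
  have comm: "comm_group ?M"
    by (rule group.group_comm_groupI[OF M]) (auto simp: add.commute)
  have homs: "fst \<in> hom ?M ?Z" "snd \<in> hom ?M ?Z" "(\<lambda>p. (fst p + snd p) mod 2) \<in> hom ?M ?Z"
    by (auto simp: hom_def Z)
  show ?thesis
  proof (rule strong_hom_propertyI[OF G M])
    show "finite (carrier ?M)" by (simp add: Z)
    fix \<phi> :: "'e \<Rightarrow> int \<times> int"
    assume \<phi>: "group_flow G ?M \<phi>"
    have even: "2 dvd divergence G (\<lambda>e. c (\<phi> e)) v" if "c \<in> hom ?M ?Z" for c v
      using integer_mod_group_flow_divergence[OF G group_flow_hom[OF G comm _ that \<phi>], of v] by simp
    obtain s1 where s1: "\<And>v. divergence G s1 v = 0" "\<And>e. e \<in> arcs G \<Longrightarrow> s1 e \<in> {fst (\<phi> e) mod 2, - (fst (\<phi> e) mod 2)}"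
      using sign_flow[OF G even[OF homs(1)]] by blast
    obtain s2 where s2: "\<And>v. divergence G s2 v = 0" "\<And>e. e \<in> arcs G \<Longrightarrow> s2 e \<in> {snd (\<phi> e) mod 2, - (snd (\<phi> e) mod 2)}"
      using sign_flow[OF G even[OF homs(2)]] by blast
    obtain s3 where s3: "\<And>v. divergence G s3 v = 0"
      "\<And>e. e \<in> arcs G \<Longrightarrow> s3 e \<in> {(fst (\<phi> e) + snd (\<phi> e)) mod 2, - ((fst (\<phi> e) + snd (\<phi> e)) mod 2)}"
      using sign_flow[OF G even[OF homs(3)]] by auto
    (* Twice the coordinate at j is the sum of chi(j) * s_chi over the three nontrivial
       characters chi of the group. *)
    define g where "g j = (if j = (0, 0) then (\<lambda>e. s1 e + s2 e + s3 e)
      else if j = (1, 0) then (\<lambda>e. s2 e - s1 e - s3 e)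
      else if j = (0, 1) then (\<lambda>e. s1 e - s2 e - s3 e)
      else (\<lambda>e. s3 e - s1 e - s2 e))" for j :: "int \<times> int"
    have arc: "\<exists>b\<in>carrier ?M. \<forall>j\<in>carrier ?M. g j e = 2 * (of_bool (j = b \<otimes>\<^bsub>?M\<^esub> \<phi> e) - of_bool (j = b))"
      if e: "e \<in> arcs G" for e
    proof -
      obtain u v where uv: "\<phi> e = (u, v)" by fastforce
      have "\<phi> e \<in> carrier ?M"
        using \<phi> e unfolding group_flow_def by blast
      then have "u \<in> {0, 1}" "v \<in> {0, 1}"
        by (auto simp: uv Z)
      then have "(u, v, s1 e, s2 e, s3 e) \<in> {(0, 0, 0, 0, 0),
          (1, 0, 1, 0, 1), (1, 0, 1, 0, - 1), (1, 0, - 1, 0, 1), (1, 0, - 1, 0, - 1),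
          (0, 1, 0, 1, 1), (0, 1, 0, 1, - 1), (0, 1, 0, - 1, 1), (0, 1, 0, - 1, - 1),
          (1, 1, 1, 1, 0), (1, 1, 1, - 1, 0), (1, 1, - 1, 1, 0), (1, 1, - 1, - 1, 0)}"
        using s1(2)[OF e] s2(2)[OF e] s3(2)[OF e] uv by (elim insertE emptyE) simp_all
      then show ?thesis
        unfolding M_carrier by (elim insertE emptyE) (simp_all add: uv g_def)
    qed
    have g_flow: "divergence G (g j) v = 0" for j v
      by (simp add: g_def net_add net_diff s1(1) s2(1) s3(1))
    have "divergence G (\<lambda>e. g j e div 2) v = 0" if j: "j \<in> carrier ?M" for j v
    proof -
      have "2 * (g j e div 2) = g j e" if e: "e \<in> arcs G" for e
      proof -
        obtain b where "g j e = 2 * (of_bool (j = b \<otimes>\<^bsub>?M\<^esub> \<phi> e) - of_bool (j = b))"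
          using arc[OF e] j by blast
        then show ?thesis by simp
      qed
      then have "2 * divergence G (\<lambda>e. g j e div 2) v = divergence G (g j) v"
        unfolding net_scale[symmetric] by (simp add: net_def)
      then show ?thesis by (simp add: g_flow)
    qed
    moreover have "\<exists>b\<in>carrier ?M. \<forall>j\<in>carrier ?M. g j e div 2 = of_bool (j = b \<otimes>\<^bsub>?M\<^esub> \<phi> e) - of_bool (j = b)"
      if e: "e \<in> arcs G" for e
    proof -
      obtain b where "b \<in> carrier ?M" and
        b: "\<And>j. j \<in> carrier ?M \<Longrightarrow> g j e = 2 * (of_bool (j = b \<otimes>\<^bsub>?M\<^esub> \<phi> e) - of_bool (j = b))"
        using arc[OF e] by blast
      show ?thesis
        by (rule bexI[OF _ \<open>b \<in> carrier ?M\<close>], rule ballI) (simp only: b, simp)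
    qed
    ultimately show "\<exists>x::'e \<Rightarrow> int \<times> int \<Rightarrow> int.
        (\<forall>j\<in>carrier ?M. \<forall>v. divergence G (\<lambda>e. x e j) v = 0) \<and>
        (\<forall>e\<in>arcs G. \<exists>b\<in>carrier ?M. \<forall>j\<in>carrier ?M.
          x e j = of_bool (j = b \<otimes>\<^bsub>?M\<^esub> \<phi> e) - of_bool (j = b))"
      by (intro exI[of _ "\<lambda>e j. g j e div 2"]) blast
  qed
qed

theorem theorem14:
  fixes G :: "('v, 'e) pre_digraph"
  assumes "fin_digraph G"
  shows "strong_hom_property TYPE('n) G (integer_mod_group 2) \<and>
         strong_hom_property TYPE('n) G (integer_mod_group 3) \<and>
         strong_hom_property TYPE('n) G (integer_mod_group 2 \<times>\<times> integer_mod_group 2) \<and>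
         strong_hom_property TYPE('n) G (integer_mod_group 4)"
  using strong_hom_property_Z2[OF assms] strong_hom_property_Z3[OF assms]
    strong_hom_property_Z2_Z2[OF assms] strong_hom_property_Z4[OF assms]
  by blast

end
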